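(* Let $L$ be a normal modal logic. The following conditions are equivalent. (1) $L$ is a logic above $\mathbf{S4}$. (2) $L$ is the logic of a general space over the Cantor space $\mathbf{C}$. (3) $L=L(\mathfrak{A})$ for some subalgebra $\mathfrak{A}$ of the closure algebra $\mathbf{C}^+$.
   Context: Modal formulas are built from a countably infinite set of propositional letters using the Boolean connectives, $\top,\bot$, and the unary operators $\Diamond,\Box$. A normal modal logic is a set of modal formulas containing all tautologies, all instances of $\Diamond(\varphi\vee\psi)\leftrightarrow(\Diamond\varphi\vee\Diamond\psi)$ and $\Box\varphi\leftrightarrow\neg\Diamond\neg\varphi$, and $\Diamond\bot\leftrightarrow\bot$, and closed under Modus Ponens, Necessitation ($\varphi/\Box\varphi$) and uniform substitution. $\mathbf{S4}$ is the least normal modal logic containing all instances of $\Diamond\Diamond\varphi\to\Diamond\varphi$ and $\varphi\to\Diamond\varphi$. A logic above $\mathbf{S4}$ is a normal modal logic containing $\mathbf{S4}$. A modal algebra is a Boolean algebra $A$ with a unary $\Diamond$ satisfying $\Diamond(a\vee b)=\Diamond a\vee\Diamond b$ and $\Diamond 0=0$; $\Box a=\neg\Diamond\neg a$. It is a closure algebra if $a\le\Diamond a$ and $\Diamond\Diamond a\le\Diamond a$ for all $a$. A formula is valid in a modal algebra if, read as a polynomial, it evaluates to $1$ under every assignment; $L(\mathfrak{A})$ is the set of formulas valid in $\mathfrak{A}$. For a topological space $X$ with closure operator $\mathbf{c}$, $X^+=(\wp(X),\mathbf{c})$ is its closure algebra. A general space over $X$ is a pair $(X,\mathcal{P})$ with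 $\mathcal{P}$ a subalgebra of $X^+$ (a field of sets over $X$ closed under topological closure); its logic is $L(\mathcal{P})$. $\mathbf{C}$ is the Cantor space with its usual topology.
   Formalization: L is assumed consistent (the inconsistent logic satisfies (1) but not (2) or (3)), and normal modal logics are also required to be closed under the rule from φ↔ψ infer ◇φ↔◇ψ, which the listed clauses do not imply and without which (1) does not give (2). *)

theory Defs
  imports "HOL-Analysis.Analysis"
begin

subsection \<open>Modal formulas and normal modal logics\<close>

datatype fm =
    Var nat
  | Top
  | Bot
  | Neg fm
  | And fm fm
  | Or fm fm
  | Imp fm fm
  | Dia fm
  | Box fm

abbreviation Iff :: "fm \<Rightarrow> fm \<Rightarrow> fm" where
  "Iff \<phi> \<psi> \<equiv> And (Imp \<phi> \<psi>) (Imp \<psi> \<phi>)"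

primrec fsubst :: "(nat \<Rightarrow> fm) \<Rightarrow> fm \<Rightarrow> fm" where
  "fsubst \<sigma> (Var n) = \<sigma> n"
| "fsubst \<sigma> Top = Top"
| "fsubst \<sigma> Bot = Bot"
| "fsubst \<sigma> (Neg \<phi>) = Neg (fsubst \<sigma> \<phi>)"
| "fsubst \<sigma> (And \<phi> \<psi>) = And (fsubst \<sigma> \<phi>) (fsubst \<sigma> \<psi>)"
| "fsubst \<sigma> (Or \<phi> \<psi>) = Or (fsubst \<sigma> \<phi>) (fsubst \<sigma> \<psi>)"
| "fsubst \<sigma> (Imp \<phi> \<psi>) = Imp (fsubst \<sigma> \<phi>) (fsubst \<sigma> \<psi>)"
| "fsubst \<sigma> (Dia \<phi>) = Dia (fsubst \<sigma> \<phi>)"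
| "fsubst \<sigma> (Box \<phi>) = Box (fsubst \<sigma> \<phi>)"

text \<open>Classical truth values. Formulas that begin with a modal operator are treated as if they
  were propositional letters, so \<open>tautology\<close> also holds of modal instances of classical tautologies.\<close>

primrec truth :: "(fm \<Rightarrow> bool) \<Rightarrow> fm \<Rightarrow> bool" where
  "truth v (Var n) = v (Var n)"
| "truth v Top = True"
| "truth v Bot = False"
| "truth v (Neg \<phi>) = (\<not> truth v \<phi>)"
| "truth v (And \<phi> \<psi>) = (truth v \<phi> \<and> truth v \<psi>)"
| "truth v (Or \<phi> \<psi>) = (truth v \<phi> \<or> truth v \<psi>)"
| "truth v (Imp \<phi> \<psi>) = (truth v \<phi> \<longrightarrow> truth v \<psi>)"
| "truth v (Dia \<phi>) = v (Dia \<phi>)"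
| "truth v (Box \<phi>) = v (Box \<phi>)"

definition tautology :: "fm \<Rightarrow> bool" where
  "tautology \<phi> \<longleftrightarrow> (\<forall>v. truth v \<phi>)"

text \<open>The congruence rule for \<open>Dia\<close> (third from last) is part of the usual notion of a normal modal
  logic, but does not follow from the other clauses: these do not even yield
  \<open>Imp (Dia (Var 0)) (Dia (Neg (Neg (Var 0))))\<close>. Without it the Lindenbaum algebra of \<open>L\<close> would not
  be a modal algebra, and \<open>L\<close> need not be the logic of any modal algebra.\<close>

definition normal_modal_logic :: "fm set \<Rightarrow> bool" where
  "normal_modal_logic L \<longleftrightarrow>
     (\<forall>\<phi>. tautology \<phi> \<longrightarrow> \<phi> \<in> L) \<and>
     (\<forall>\<phi> \<psi>. Iff (Dia (Or \<phi> \<psi>)) (Or (Dia \<phi>) (Dia \<psi>)) \<in> L) \<and>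
     (\<forall>\<phi>. Iff (Box \<phi>) (Neg (Dia (Neg \<phi>))) \<in> L) \<and>
     Iff (Dia Bot) Bot \<in> L \<and>
     (\<forall>\<phi> \<psi>. \<phi> \<in> L \<longrightarrow> Imp \<phi> \<psi> \<in> L \<longrightarrow> \<psi> \<in> L) \<and>
     (\<forall>\<phi> \<psi>. Iff \<phi> \<psi> \<in> L \<longrightarrow> Iff (Dia \<phi>) (Dia \<psi>) \<in> L) \<and>
     (\<forall>\<phi>. \<phi> \<in> L \<longrightarrow> Box \<phi> \<in> L) \<and>
     (\<forall>\<sigma> \<phi>. \<phi> \<in> L \<longrightarrow> fsubst \<sigma> \<phi> \<in> L)"

definition S4 :: "fm set" where
  "S4 = \<Inter> {L. normal_modal_logic L \<and>
              (\<forall>\<phi>. Imp (Dia (Dia \<phi>)) (Dia \<phi>) \<in> L) \<and>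
              (\<forall>\<phi>. Imp \<phi> (Dia \<phi>) \<in> L)}"

definition logic_above_S4 :: "fm set \<Rightarrow> bool" where
  "logic_above_S4 L \<longleftrightarrow> normal_modal_logic L \<and> S4 \<subseteq> L"

subsection \<open>Modal algebras\<close>

record 'a modal_alg =
  carrier :: "'a set"
  join :: "'a \<Rightarrow> 'a \<Rightarrow> 'a"
  meet :: "'a \<Rightarrow> 'a \<Rightarrow> 'a"
  cmpl :: "'a \<Rightarrow> 'a"
  zero_el :: 'a
  one_el :: 'a
  dia :: "'a \<Rightarrow> 'a"

text \<open>The Boolean part of the axioms is Huntington's axiomatization.\<close>

locale modal_algebra =
  fixes A :: "'a modal_alg"
  assumes zero_closed: "zero_el A \<in> carrier A"
    and one_closed: "one_el A \<in> carrier A"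
    and join_closed: "\<lbrakk>a \<in> carrier A; b \<in> carrier A\<rbrakk> \<Longrightarrow> join A a b \<in> carrier A"
    and meet_closed: "\<lbrakk>a \<in> carrier A; b \<in> carrier A\<rbrakk> \<Longrightarrow> meet A a b \<in> carrier A"
    and cmpl_closed: "a \<in> carrier A \<Longrightarrow> cmpl A a \<in> carrier A"
    and dia_closed: "a \<in> carrier A \<Longrightarrow> dia A a \<in> carrier A"
    and join_commute: "\<lbrakk>a \<in> carrier A; b \<in> carrier A\<rbrakk> \<Longrightarrow> join A a b = join A b a"
    and meet_commute: "\<lbrakk>a \<in> carrier A; b \<in> carrier A\<rbrakk> \<Longrightarrow> meet A a b = meet A b a"
    and join_meet_distrib: "\<lbrakk>a \<in> carrier A; b \<in> carrier A; c \<in> carrier A\<rbrakk> \<Longrightarrow>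
          join A a (meet A b c) = meet A (join A a b) (join A a c)"
    and meet_join_distrib: "\<lbrakk>a \<in> carrier A; b \<in> carrier A; c \<in> carrier A\<rbrakk> \<Longrightarrow>
          meet A a (join A b c) = join A (meet A a b) (meet A a c)"
    and join_zero: "a \<in> carrier A \<Longrightarrow> join A a (zero_el A) = a"
    and meet_one: "a \<in> carrier A \<Longrightarrow> meet A a (one_el A) = a"
    and join_cmpl: "a \<in> carrier A \<Longrightarrow> join A a (cmpl A a) = one_el A"
    and meet_cmpl: "a \<in> carrier A \<Longrightarrow> meet A a (cmpl A a) = zero_el A"
    and dia_join: "\<lbrakk>a \<in> carrier A; b \<in> carrier A\<rbrakk> \<Longrightarrow>
          dia A (join A a b) = join A (dia A a) (dia A b)"
    and dia_zero: "dia A (zero_el A) = zero_el A"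

text \<open>In a Boolean algebra \<open>a \<le> b\<close> means \<open>join A a b = b\<close>.\<close>

locale closure_algebra = modal_algebra +
  assumes dia_increasing: "a \<in> carrier A \<Longrightarrow> join A a (dia A a) = dia A a"
    and dia_dia_le: "a \<in> carrier A \<Longrightarrow> join A (dia A (dia A a)) (dia A a) = dia A a"

definition subalgebra :: "'a modal_alg \<Rightarrow> 'a modal_alg \<Rightarrow> bool" where
  "subalgebra B A \<longleftrightarrow>
     carrier B \<subseteq> carrier A \<and>
     B = A\<lparr>carrier := carrier B\<rparr> \<and>
     zero_el A \<in> carrier B \<and>
     one_el A \<in> carrier B \<and>
     (\<forall>a\<in>carrier B. \<forall>b\<in>carrier B. join A a b \<in> carrier B) \<and>
     (\<forall>a\<in>carrier B. \<forall>b\<in>carrier B. meet A a b \<in> carrier B) \<and>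
     (\<forall>a\<in>carrier B. cmpl A a \<in> carrier B) \<and>
     (\<forall>a\<in>carrier B. dia A a \<in> carrier B)"

primrec eval_fm :: "'a modal_alg \<Rightarrow> (nat \<Rightarrow> 'a) \<Rightarrow> fm \<Rightarrow> 'a" where
  "eval_fm A v (Var n) = v n"
| "eval_fm A v Top = one_el A"
| "eval_fm A v Bot = zero_el A"
| "eval_fm A v (Neg \<phi>) = cmpl A (eval_fm A v \<phi>)"
| "eval_fm A v (And \<phi> \<psi>) = meet A (eval_fm A v \<phi>) (eval_fm A v \<psi>)"
| "eval_fm A v (Or \<phi> \<psi>) = join A (eval_fm A v \<phi>) (eval_fm A v \<psi>)"
| "eval_fm A v (Imp \<phi> \<psi>) = join A (cmpl A (eval_fm A v \<phi>)) (eval_fm A v \<psi>)"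
| "eval_fm A v (Dia \<phi>) = dia A (eval_fm A v \<phi>)"
| "eval_fm A v (Box \<phi>) = cmpl A (dia A (cmpl A (eval_fm A v \<phi>)))"

definition alg_valid :: "'a modal_alg \<Rightarrow> fm \<Rightarrow> bool" where
  "alg_valid A \<phi> \<longleftrightarrow> (\<forall>v. range v \<subseteq> carrier A \<longrightarrow> eval_fm A v \<phi> = one_el A)"

definition alg_logic :: "'a modal_alg \<Rightarrow> fm set" where
  "alg_logic A = {\<phi>. alg_valid A \<phi>}"

subsection \<open>General spaces\<close>

definition space_algebra :: "'a topology \<Rightarrow> 'a set modal_alg" where
  "space_algebra X =
     \<lparr>carrier = Pow (topspace X), join = (\<union>), meet = (\<inter>), cmpl = (\<lambda>S. topspace X - S),
      zero_el = {}, one_el = topspace X, dia = (\<lambda>S. X closure_of S)\<rparr>"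

lemma closure_algebra_space_algebra: "closure_algebra (space_algebra X)"
  by unfold_locales
    (auto simp: space_algebra_def dest: closure_of_subset subsetD[OF closure_of_subset_topspace]
          subsetD[OF closure_of_subset])

definition general_space :: "'a topology \<Rightarrow> 'a set set \<Rightarrow> bool" where
  "general_space X P \<longleftrightarrow> algebra (topspace X) P \<and> (\<forall>S\<in>P. X closure_of S \<in> P)"

definition general_space_logic :: "'a topology \<Rightarrow> 'a set set \<Rightarrow> fm set" where
  "general_space_logic X P = alg_logic ((space_algebra X)\<lparr>carrier := P\<rparr>)"

definition cantor_space :: "(nat \<Rightarrow> bool) topology" where
  "cantor_space = product_topology (\<lambda>_. discrete_topology UNIV) UNIV"

end

theory Submission
  imports Defs
begin

text \<open>
  A subalgebra of the closure algebra of the Cantor space is determined by its carrier, and the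
  possible carriers are the general spaces; so the second and third conditions differ only in
  wording. They imply the first because a topological closure operator is increasing and idempotent.
  The substance is to realize a consistent logic \<open>L\<close> above S4 by a general space.

  Take the canonical model of \<open>L\<close>: its points are the complete theories containing \<open>L\<close>, and \<open>w\<close>
  sees \<open>v\<close> if \<open>Dia \<psi> \<in> w\<close> for all \<open>\<psi> \<in> v\<close>. Given a complete theory \<open>w\<close>, unravel the model into
  the infinite binary tree, whose branches form the Cantor space. The root is labelled \<open>w\<close>. A bit
  \<open>False\<close> keeps the label; a bit \<open>True\<close> at depth \<open>n\<close> moves to a visible theory containing the \<open>n\<close>-th
  formula \<open>\<psi>\<close> of an agenda, if \<open>Dia \<psi>\<close> is in the label. Every formula recurs on the agenda, so
  each node has a descendant for each of its demands \<open>Dia \<psi>\<close>.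

  The labels along a branch need not stabilize. But the formulas that are eventually in the labels
  form a consistent theory, and any completion of it serves as label of the branch. Labels follow
  the relation \<open>sees\<close>, which is transitive by the axiom 4, so a formula \<open>Dia \<psi>\<close> that leaves the
  labels never returns. Hence every completion contains \<open>Dia \<psi>\<close> exactly if all labels along the
  branch do (\<open>dia_in_limit_label_iff\<close>). It follows that the set of branches whose limit contains
  \<open>Dia \<psi>\<close> is the closure of the set of those whose limit contains \<open>\<psi>\<close> (\<open>truth_set_dia\<close>).
  These sets of branches therefore form a general space, which validates \<open>L\<close> and refutes every
  formula outside \<open>w\<close>.

  One complete theory does not suffice in general, but countably many do: one omitting \<open>\<phi>\<close> for each
  \<open>\<phi> \<notin> L\<close>. The Cantor space is the disjoint union of one point and countably many clopen copies
  of itself that converge to this point. Given a general space on each copy, the sets that induce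
  one of its members on each copy and are constantly full or constantly empty on the copies near the
  point (and contain the point accordingly) again form a general space, and its logic is the intersection
  of the given logics (\<open>general_space_logic_cantor_sum\<close>).
\<close>

section \<open>The Cantor space and its closure algebra\<close>

lemma topspace_cantor [simp]: "topspace cantor_space = UNIV"
  by (simp add: cantor_space_def)

lemma openin_cylinder: "openin cantor_space {y. \<forall>i<n. y i = x i}"
proof -
  have "{y. \<forall>i<n. y i = x i} = PiE UNIV (\<lambda>i. if i < n then {x i} else UNIV)"
    by (auto simp: PiE_def Pi_def split: if_splits)
  moreover have "finite {i. (if i < n then {x i} else UNIV) \<noteq> (UNIV :: bool set)}"
    by (rule finite_subset[of _ "{..<n}"]) auto
  ultimately show ?thesis
    unfolding cantor_space_def by (simp add: openin_PiE_gen)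
qed

text \<open>A basic open set of the product constrains finitely many coordinates; a cylinder that fixes all
  coordinates up to a bound is contained in it.\<close>

lemma cylinder_in_open:
  assumes "openin cantor_space U" "x \<in> U"
  obtains n where "{y. \<forall>i<n. y i = x i} \<subseteq> U"
proof -
  obtain V where V: "finite {i. V i \<noteq> (UNIV :: bool set)}" "x \<in> PiE UNIV V" "PiE UNIV V \<subseteq> U"
    using assms unfolding cantor_space_def openin_product_topology_alt by auto
  obtain n where n: "\<And>i. V i \<noteq> UNIV \<Longrightarrow> i < n"
    using finite_nat_set_iff_bounded[THEN iffD1, OF V(1)] by blast
  have "{y. \<forall>i<n. y i = x i} \<subseteq> PiE UNIV V"
  proof (clarsimp simp: PiE_def Pi_def)
    fix y i assume "\<forall>i<n. y i = x i"
    then show "y i \<in> V i"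
      using n[of i] V(2) by (cases "V i = UNIV") auto
  qed
  also note V(3)
  finally show thesis by (rule that)
qed

lemma in_closure_cantor_iff:
  "x \<in> cantor_space closure_of S \<longleftrightarrow> (\<forall>n. \<exists>y\<in>S. \<forall>i<n. y i = x i)"
proof
  assume "x \<in> cantor_space closure_of S"
  then have cl: "\<exists>y\<in>S. y \<in> U" if "openin cantor_space U" "x \<in> U" for U
    using that unfolding in_closure_of by blast
  show "\<forall>n. \<exists>y\<in>S. \<forall>i<n. y i = x i"
  proof
    fix n show "\<exists>y\<in>S. \<forall>i<n. y i = x i" using cl[OF openin_cylinder[of n x]] by simp
  qed
next
  assume *: "\<forall>n. \<exists>y\<in>S. \<forall>i<n. y i = x i"
  show "x \<in> cantor_space closure_of S"
    unfolding in_closure_of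
  proof (intro conjI allI impI)
    fix U assume "x \<in> U \<and> openin cantor_space U"
    then obtain n where "{y. \<forall>i<n. y i = x i} \<subseteq> U" using cylinder_in_open by blast
    with * show "\<exists>y. y \<in> S \<and> y \<in> U" by blast
  qed simp
qed

text \<open>Formula evaluation does not look at the carrier, so all general spaces over the Cantor space
  share this evaluation; they differ only in the admissible valuations.\<close>

abbreviation cantor_eval :: "(nat \<Rightarrow> (nat \<Rightarrow> bool) set) \<Rightarrow> fm \<Rightarrow> (nat \<Rightarrow> bool) set" where
  "cantor_eval \<equiv> eval_fm (space_algebra cantor_space)"

lemma eval_fm_carrier_update: "eval_fm (A\<lparr>carrier := P\<rparr>) v \<phi> = eval_fm A v \<phi>"
  by (induction \<phi>) simp_all

lemma mem_general_space_logic_cantor: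
  "\<phi> \<in> general_space_logic cantor_space P \<longleftrightarrow>
     (\<forall>v. range v \<subseteq> P \<longrightarrow> cantor_eval v \<phi> = UNIV)"
  by (simp add: general_space_logic_def alg_logic_def alg_valid_def eval_fm_carrier_update)
     (simp add: space_algebra_def)

lemma general_space_logic_cantorD:
  assumes "\<phi> \<in> general_space_logic cantor_space P" "range v \<subseteq> P"
  shows "cantor_eval v \<phi> = UNIV"
  using assms(1)[unfolded mem_general_space_logic_cantor, rule_format, OF assms(2)] .

lemma general_space_cantor_iff:
  "general_space cantor_space P \<longleftrightarrow>
     {} \<in> P \<and> (\<forall>S\<in>P. - S \<in> P) \<and> (\<forall>S\<in>P. \<forall>T\<in>P. S \<union> T \<in> P) \<and>
     (\<forall>S\<in>P. cantor_space closure_of S \<in> P)"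
  by (auto simp: general_space_def algebra_iff_Un Compl_eq_Diff_UNIV)

lemma eval_fm_in_general_space:
  assumes "general_space cantor_space P" "range v \<subseteq> P"
  shows "cantor_eval v \<phi> \<in> P"
proof -
  have c: "- S \<in> P" "cantor_space closure_of S \<in> P" if "S \<in> P" for S
    using assms(1) that by (auto simp: general_space_cantor_iff)
  have u: "S \<union> T \<in> P" if "S \<in> P" "T \<in> P" for S T
    using assms(1) that by (auto simp: general_space_cantor_iff)
  have e: "{} \<in> P" using assms(1) by (auto simp: general_space_cantor_iff)
  have i: "S \<inter> T \<in> P" if "S \<in> P" "T \<in> P" for S T
    using c(1)[OF u[OF c(1) c(1)], OF that] by simp
  have n: "UNIV \<in> P" using c(1)[OF e] by simp
  show ?thesis
    using assms(2)
    by (induction \<phi>)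
       (auto simp: space_algebra_def c u i e n Compl_eq_Diff_UNIV[symmetric])
qed

section \<open>Countable sums of general spaces over the Cantor space\<close>

text \<open>\<open>piece k\<close> embeds the Cantor space onto the sequences whose first \<open>True\<close> is at position \<open>k\<close>.
  These clopen copies converge to the remaining point, the constant sequence \<open>False\<close>.\<close>

definition piece :: "nat \<Rightarrow> (nat \<Rightarrow> bool) \<Rightarrow> nat \<Rightarrow> bool" where
  "piece k y n = (if n < k then False else if n = k then True else y (n - Suc k))"

lemma piece_cases:
  obtains "x = (\<lambda>_. False)" | k y where "x = piece k y"
proof (cases "\<exists>k. x k")
  case False
  then show thesis using that(1) by auto
next
  case True
  define k where "k = (LEAST k. x k)"
  have "x k" using True unfolding k_def by (metis LeastI)
  moreover have "\<not> x i" if "i < k" for i using that not_less_Least unfolding k_def by blast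
  ultimately have "x = piece k (\<lambda>n. x (n + Suc k))"
    by (auto simp: piece_def fun_eq_iff)
  then show thesis using that(2) by blast
qed

lemma piece_agree_imp_eq_piece:
  assumes "\<forall>i<Suc k. z i = piece k y i"
  shows "z = piece k (\<lambda>n. z (n + Suc k))"
  using assms by (auto simp: piece_def fun_eq_iff)

lemma piece_eq_iff [simp]: "piece j x = piece k y \<longleftrightarrow> j = k \<and> x = y"
proof
  assume eq: "piece j x = piece k y"
  have "j = k"
  proof (rule linorder_cases[of j k])
    assume "j < k" then show ?thesis using fun_cong[OF eq, of j] by (simp add: piece_def)
  next
    assume "k < j" then show ?thesis using fun_cong[OF eq, of k] by (simp add: piece_def)
  qed simp
  moreover have "x n = y n" for n
    using fun_cong[OF eq, of "n + Suc k"] \<open>j = k\<close> by (simp add: piece_def)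
  ultimately show "j = k \<and> x = y" by auto
qed simp

lemma piece_neq_zero [simp]: "piece k y \<noteq> (\<lambda>_. False)" "(\<lambda>_. False) \<noteq> piece k y"
  by (auto simp: piece_def fun_eq_iff)

text \<open>An open embedding commutes with closure under preimages; concretely, a point that agrees with
  \<open>piece k y\<close> up to and including position \<open>k\<close> lies in the same copy. With it, evaluation can be
  done copy by copy.\<close>

lemma piece_vimage_closure:
  "piece k -` (cantor_space closure_of S) = cantor_space closure_of (piece k -` S)"
proof (intro set_eqI iffI)
  fix y assume "y \<in> piece k -` (cantor_space closure_of S)"
  then have *: "\<exists>z\<in>S. \<forall>i<n. z i = piece k y i" for n
    by (simp add: in_closure_cantor_iff)
  show "y \<in> cantor_space closure_of (piece k -` S)"
    unfolding in_closure_cantor_iff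
  proof
    fix n
    obtain z where z: "z \<in> S" "\<forall>i<n + Suc k. z i = piece k y i" using *[of "n + Suc k"] by blast
    define y' where "y' n = z (n + Suc k)" for n
    have "z = piece k y'"
      unfolding y'_def using z(2) by (intro piece_agree_imp_eq_piece) auto
    moreover have "y' i = y i" if "i < n" for i
      using z(2) that by (simp add: y'_def piece_def)
    ultimately show "\<exists>y'\<in>piece k -` S. \<forall>i<n. y' i = y i" using z(1) by auto
  qed
next
  fix y assume "y \<in> cantor_space closure_of (piece k -` S)"
  then have *: "\<exists>z. piece k z \<in> S \<and> (\<forall>i<n. z i = y i)" for n
    by (auto simp: in_closure_cantor_iff)
  show "y \<in> piece k -` (cantor_space closure_of S)"
    unfolding vimage_eq in_closure_cantor_iff
  proof
    fix n
    obtain z where "piece k z \<in> S" "\<forall>i<n. z i = y i" using * by blast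
    then show "\<exists>z\<in>S. \<forall>i<n. z i = piece k y i"
      by (intro bexI[of _ "piece k z"]) (auto simp: piece_def)
  qed
qed

lemma piece_vimage_eval:
  "piece k -` cantor_eval v \<phi> = cantor_eval (\<lambda>n. piece k -` v n) \<phi>"
  by (induction \<phi>)
     (simp_all add: space_algebra_def piece_vimage_closure Compl_eq_Diff_UNIV[symmetric] vimage_Compl)

text \<open>The eventual constancy is what keeps the limit point harmless: it decides the membership of
  the point without allowing the sets to oscillate on the copies that converge to it.\<close>

definition cantor_sum :: "(nat \<Rightarrow> (nat \<Rightarrow> bool) set set) \<Rightarrow> (nat \<Rightarrow> bool) set set" where
  "cantor_sum P = {S. (\<forall>k. piece k -` S \<in> P k) \<and>
     (\<forall>\<^sub>F k in sequentially. piece k -` S = (if (\<lambda>_. False) \<in> S then UNIV else {}))}"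

text \<open>If the point is not in \<open>S\<close>, then \<open>S\<close> is disjoint from almost all copies, and the point
  together with these copies is a neighbourhood avoiding \<open>S\<close>.\<close>

lemma zero_in_closure_iff:
  assumes ev: "\<forall>\<^sub>F k in sequentially. piece k -` S = (if (\<lambda>_. False) \<in> S then UNIV else {})"
  shows "(\<lambda>_. False) \<in> cantor_space closure_of S \<longleftrightarrow> (\<lambda>_. False) \<in> S"
proof
  assume cl: "(\<lambda>_. False) \<in> cantor_space closure_of S"
  show "(\<lambda>_. False) \<in> S"
  proof (rule ccontr)
    assume n: "(\<lambda>_. False) \<notin> S"
    then obtain N where N: "\<And>k. k \<ge> N \<Longrightarrow> piece k -` S = {}"
      using ev unfolding eventually_sequentially by auto
    obtain y where y: "y \<in> S" "\<forall>i<N. y i = False" using cl unfolding in_closure_cantor_iff by blast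
    show False
    proof (cases y rule: piece_cases)
      case 1 then show False using n y by simp
    next
      case (2 k z)
      then have "k \<ge> N" using y(2) by (auto simp: piece_def not_le[symmetric])
      then show False using N[of k] 2 y(1) by auto
    qed
  qed
next
  assume "(\<lambda>_. False) \<in> S"
  then show "(\<lambda>_. False) \<in> cantor_space closure_of S" by (auto simp: in_closure_cantor_iff)
qed

lemma general_space_cantor_sum:
  assumes P: "\<And>k. general_space cantor_space (P k)"
  shows "general_space cantor_space (cantor_sum P)"
  unfolding general_space_cantor_iff
proof (intro conjI ballI)
  note P' = P[unfolded general_space_cantor_iff]
  show "{} \<in> cantor_sum P" using P' by (simp add: cantor_sum_def)
  fix S assume S: "S \<in> cantor_sum P"
  then have ev: "\<forall>\<^sub>F k in sequentially. piece k -` S = (if (\<lambda>_. False) \<in> S then UNIV else {})"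
    by (simp add: cantor_sum_def)
  show "- S \<in> cantor_sum P"
    using P' S unfolding cantor_sum_def
    by (auto simp: vimage_Compl elim!: eventually_mono split: if_splits)
  show "cantor_space closure_of S \<in> cantor_sum P"
    unfolding cantor_sum_def mem_Collect_eq zero_in_closure_iff[OF ev] piece_vimage_closure
  proof (intro conjI allI)
    show "cantor_space closure_of piece k -` S \<in> P k" for k
      using P' S by (simp add: cantor_sum_def)
    have [simp]: "cantor_space closure_of UNIV = UNIV"
      using closure_of_topspace[of cantor_space] by simp
    show "\<forall>\<^sub>F k in sequentially. cantor_space closure_of piece k -` S =
            (if (\<lambda>_. False) \<in> S then UNIV else {})"
      using ev by eventually_elim (simp split: if_splits)
  qed
  fix T assume T: "T \<in> cantor_sum P"
  show "S \<union> T \<in> cantor_sum P"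
    unfolding cantor_sum_def mem_Collect_eq vimage_Un
  proof (intro conjI allI)
    show "piece k -` S \<union> piece k -` T \<in> P k" for k
      using P' S T by (simp add: cantor_sum_def)
    have "\<forall>\<^sub>F k in sequentially. piece k -` T = (if (\<lambda>_. False) \<in> T then UNIV else {})"
      using T by (simp add: cantor_sum_def)
    with ev show "\<forall>\<^sub>F k in sequentially. piece k -` S \<union> piece k -` T =
            (if (\<lambda>_. False) \<in> S \<union> T then UNIV else {})"
      by eventually_elim (auto split: if_splits)
  qed
qed

text \<open>A refutation on one copy extends to the sum by the empty set on the others. Conversely, a
  formula valid on all copies takes a value that includes all copies; this value belongs to the sum,
  so it cannot be eventually empty and must contain the limit point too.\<close>

lemma general_space_logic_cantor_sum:
  assumes P: "\<And>k. general_space cantor_space (P k)"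
  shows "general_space_logic cantor_space (cantor_sum P) =
           (\<Inter>k. general_space_logic cantor_space (P k))"
proof (intro set_eqI iffI INT_I)
  fix \<phi> k assume \<phi>: "\<phi> \<in> general_space_logic cantor_space (cantor_sum P)"
  show "\<phi> \<in> general_space_logic cantor_space (P k)"
    unfolding mem_general_space_logic_cantor
  proof (intro allI impI)
    fix v :: "nat \<Rightarrow> (nat \<Rightarrow> bool) set" assume v: "range v \<subseteq> P k"
    have vim: "piece j -` (piece k ` S) = (if j = k then S else {})" for j S
      by auto
    have ev: "\<forall>\<^sub>F j in sequentially. (if j = k then v n else {}) = {}" for n
      using eventually_gt_at_top[of k] by eventually_elim auto
    have "range (\<lambda>n. piece k ` v n) \<subseteq> cantor_sum P"
      using v P[unfolded general_space_cantor_iff]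
      by (auto simp: cantor_sum_def vim ev image_iff)
    with \<phi> have "cantor_eval (\<lambda>n. piece k ` v n) \<phi> = UNIV"
      by (rule general_space_logic_cantorD)
    then show "cantor_eval v \<phi> = UNIV"
      using piece_vimage_eval[of k "\<lambda>n. piece k ` v n" \<phi>] by (simp add: vim)
  qed
next
  fix \<phi> assume \<phi>: "\<phi> \<in> (\<Inter>k. general_space_logic cantor_space (P k))"
  show "\<phi> \<in> general_space_logic cantor_space (cantor_sum P)"
    unfolding mem_general_space_logic_cantor
  proof (intro allI impI)
    fix v :: "nat \<Rightarrow> (nat \<Rightarrow> bool) set" assume v: "range v \<subseteq> cantor_sum P"
    let ?E = "cantor_eval v \<phi>"
    have full: "piece k -` ?E = UNIV" for k
    proof -
      have "range (\<lambda>n. piece k -` v n) \<subseteq> P k" using v by (auto simp: cantor_sum_def)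
      with INT_D[OF \<phi> UNIV_I] show ?thesis
        unfolding piece_vimage_eval by (rule general_space_logic_cantorD)
    qed
    have "?E \<in> cantor_sum P"
      using eval_fm_in_general_space[OF general_space_cantor_sum[OF P] v] .
    then have zero: "(\<lambda>_. False) \<in> ?E"
      by (auto simp: cantor_sum_def full split: if_splits)
    have "x \<in> ?E" for x
      by (cases x rule: piece_cases) (use zero full in auto)
    then show "?E = UNIV" by blast
  qed
qed

section \<open>Complete theories\<close>

locale S4_logic =
  fixes L :: "fm set"
  assumes normal: "normal_modal_logic L"
    and refl_axiom: "Imp \<phi> (Dia \<phi>) \<in> L"
    and trans_axiom: "Imp (Dia (Dia \<phi>)) (Dia \<phi>) \<in> L"
begin

text \<open>A theory is closed under Modus Ponens only: Necessitation and substitution would not hold for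
  the truths at a single point of a model.\<close>

definition is_theory :: "fm set \<Rightarrow> bool" where
  "is_theory T \<longleftrightarrow> L \<subseteq> T \<and> (\<forall>\<phi> \<psi>. \<phi> \<in> T \<longrightarrow> Imp \<phi> \<psi> \<in> T \<longrightarrow> \<psi> \<in> T)"

definition complete_theory :: "fm set \<Rightarrow> bool" where
  "complete_theory T \<longleftrightarrow> is_theory T \<and> (\<forall>\<phi>. Neg \<phi> \<in> T \<longleftrightarrow> \<phi> \<notin> T)"

lemmas normal_unfolded = normal[unfolded normal_modal_logic_def]

lemmas taut = normal_unfolded[THEN conjunct1, rule_format]
  and dia_or = normal_unfolded[THEN conjunct2, THEN conjunct1, rule_format]
  and box_dual = normal_unfolded[THEN conjunct2, THEN conjunct2, THEN conjunct1, rule_format]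
  and dia_bot = normal_unfolded[THEN conjunct2, THEN conjunct2, THEN conjunct2, THEN conjunct1, rule_format]
  and modus_ponens = normal_unfolded[THEN conjunct2, THEN conjunct2, THEN conjunct2, THEN conjunct2, THEN conjunct1, rule_format]
  and dia_cong = normal_unfolded[THEN conjunct2, THEN conjunct2, THEN conjunct2, THEN conjunct2,
  THEN conjunct2, THEN conjunct1, rule_format]
  and subst = normal_unfolded[THEN conjunct2, THEN conjunct2, THEN conjunct2, THEN conjunct2,
  THEN conjunct2, THEN conjunct2, THEN conjunct2, rule_format]

lemma is_theory_L: "is_theory L"
  unfolding is_theory_def by (intro conjI allI impI subset_refl) (rule modus_ponens)

lemma theory_mp:
  assumes "is_theory T" "\<phi> \<in> T" "Imp \<phi> \<psi> \<in> T"
  shows "\<psi> \<in> T"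
  using assms(1)[unfolded is_theory_def, THEN conjunct2, rule_format, OF assms(2,3)] .

lemma theory_supset:
  assumes "is_theory T" "\<phi> \<in> L"
  shows "\<phi> \<in> T"
  using assms(1)[unfolded is_theory_def, THEN conjunct1] assms(2) by (rule subsetD)

lemma theory_taut: "is_theory T \<Longrightarrow> tautology \<phi> \<Longrightarrow> \<phi> \<in> T"
  by (rule theory_supset[OF _ taut])

lemma theory_taut1:
  assumes "is_theory T" "\<phi> \<in> T" "tautology (Imp \<phi> \<psi>)"
  shows "\<psi> \<in> T"
  by (rule theory_mp[OF assms(1,2) theory_taut[OF assms(1,3)]])

lemma theory_taut2:
  assumes "is_theory T" "\<phi> \<in> T" "\<psi> \<in> T" "tautology (Imp \<phi> (Imp \<psi> \<theta>))"
  shows "\<theta> \<in> T"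
  by (rule theory_mp[OF assms(1,3) theory_mp[OF assms(1,2) theory_taut[OF assms(1,4)]]])

lemma dia_mono:
  assumes "Imp \<phi> \<psi> \<in> L"
  shows "Imp (Dia \<phi>) (Dia \<psi>) \<in> L"
proof -
  have "Iff (Or \<phi> \<psi>) \<psi> \<in> L"
    by (rule theory_taut1[OF is_theory_L assms]) (simp add: tautology_def)
  then show ?thesis
    by (rule theory_taut2[OF is_theory_L dia_cong dia_or[of \<phi> \<psi>]]) (simp add: tautology_def)
qed

lemma complete_theory_theory: "complete_theory w \<Longrightarrow> is_theory w"
  and complete_theory_neg: "complete_theory w \<Longrightarrow> Neg \<phi> \<in> w \<longleftrightarrow> \<phi> \<notin> w"
  by (auto simp: complete_theory_def)

lemma complete_theory_L: "complete_theory w \<Longrightarrow> \<phi> \<in> L \<Longrightarrow> \<phi> \<in> w"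
  by (rule theory_supset[OF complete_theory_theory])

lemma complete_theory_imp:
  assumes w: "complete_theory w"
  shows "Imp \<phi> \<psi> \<in> w \<longleftrightarrow> (\<phi> \<in> w \<longrightarrow> \<psi> \<in> w)"
proof
  assume "\<phi> \<in> w \<longrightarrow> \<psi> \<in> w"
  then consider "Neg \<phi> \<in> w" | "\<psi> \<in> w" using complete_theory_neg[OF w] by blast
  then show "Imp \<phi> \<psi> \<in> w"
    by cases (erule theory_taut1[OF complete_theory_theory[OF w]]; simp add: tautology_def)+
next
  assume "Imp \<phi> \<psi> \<in> w"
  then show "\<phi> \<in> w \<longrightarrow> \<psi> \<in> w"
    using theory_mp[OF complete_theory_theory[OF w]] by blast
qed

lemma complete_theory_and:
  assumes w: "complete_theory w"
  shows "And \<phi> \<psi> \<in> w \<longleftrightarrow> \<phi> \<in> w \<and> \<psi> \<in> w"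
proof -
  note t = complete_theory_theory[OF w]
  show ?thesis
    using theory_taut1[OF t, of "And \<phi> \<psi>" \<phi>] theory_taut1[OF t, of "And \<phi> \<psi>" \<psi>]
      theory_taut2[OF t, of \<phi> \<psi> "And \<phi> \<psi>"]
    by (auto simp: tautology_def)
qed

lemma complete_theory_iff:
  assumes w: "complete_theory w" and "Iff \<phi> \<psi> \<in> L"
  shows "\<phi> \<in> w \<longleftrightarrow> \<psi> \<in> w"
  using complete_theory_L[OF assms]
  by (auto simp: complete_theory_and[OF w] complete_theory_imp[OF w])

lemma complete_theory_or:
  assumes w: "complete_theory w"
  shows "Or \<phi> \<psi> \<in> w \<longleftrightarrow> \<phi> \<in> w \<or> \<psi> \<in> w"
proof -
  have "Iff (Or \<phi> \<psi>) (Imp (Neg \<phi>) \<psi>) \<in> L" by (rule taut) (auto simp: tautology_def)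
  from complete_theory_iff[OF w this] show ?thesis
    by (auto simp: complete_theory_imp[OF w] complete_theory_neg[OF w])
qed

lemma complete_theory_top_bot:
  assumes w: "complete_theory w"
  shows "Top \<in> w" "Bot \<notin> w"
proof -
  have "Top \<in> L" "Neg Bot \<in> L" by (auto intro!: taut simp: tautology_def)
  then show "Top \<in> w" "Bot \<notin> w"
    using complete_theory_L[OF w] complete_theory_neg[OF w] by blast+
qed

lemma complete_theory_box:
  assumes w: "complete_theory w"
  shows "Box \<phi> \<in> w \<longleftrightarrow> Neg (Dia (Neg \<phi>)) \<in> w"
  using complete_theory_iff[OF w box_dual] .

text \<open>Lindenbaum's lemma. Zorn's lemma gives a theory \<open>w\<close> that is maximal among those omitting \<open>\<phi>\<close>.
  By maximality, \<open>\<phi>\<close> follows in \<open>w\<close> from every formula that \<open>w\<close> omits; so \<open>w\<close> cannot omit both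
  \<open>\<theta>\<close> and \<open>Neg \<theta>\<close>, as their disjunction is a tautology.\<close>

lemma complete_theory_extends:
  assumes T: "is_theory T" and \<phi>: "\<phi> \<notin> T"
  obtains w where "complete_theory w" "T \<subseteq> w" "\<phi> \<notin> w"
proof -
  let ?A = "{U. is_theory U \<and> T \<subseteq> U \<and> \<phi> \<notin> U}"
  have "\<exists>M\<in>?A. \<forall>X\<in>?A. M \<subseteq> X \<longrightarrow> X = M"
  proof (rule subset_Zorn_nonempty)
    show "?A \<noteq> {}" using T \<phi> by blast
    fix \<C> assume ne: "\<C> \<noteq> {}" and ch: "subset.chain ?A \<C>"
    have "is_theory (\<Union>\<C>)"
      unfolding is_theory_def
    proof (intro conjI allI impI)
      obtain U where U: "U \<in> \<C>" using ne by blast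
      then have "is_theory U" using ch unfolding subset.chain_def by blast
      then show "L \<subseteq> \<Union>\<C>" using U by (blast dest: theory_supset)
      fix \<alpha> \<beta> assume "\<alpha> \<in> \<Union>\<C>" "Imp \<alpha> \<beta> \<in> \<Union>\<C>"
      then obtain U V where "U \<in> \<C>" "\<alpha> \<in> U" "V \<in> \<C>" "Imp \<alpha> \<beta> \<in> V" by blast
      then obtain W where "W \<in> \<C>" "\<alpha> \<in> W" "Imp \<alpha> \<beta> \<in> W"
        using ch subset_chain_def[of ?A \<C>] by blast
      moreover have "is_theory W" using ch \<open>W \<in> \<C>\<close> unfolding subset.chain_def by blast
      ultimately show "\<beta> \<in> \<Union>\<C>" using theory_mp[of W \<alpha> \<beta>] by blast
    qed
    then show "\<Union>\<C> \<in> ?A" using ne ch unfolding subset.chain_def by blast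
  qed
  then obtain w where "w \<in> ?A" and maximal: "\<forall>X\<in>?A. w \<subseteq> X \<longrightarrow> X = w" ..
  then have w: "is_theory w" "T \<subseteq> w" "\<phi> \<notin> w" by simp_all
  have ext: "Imp \<theta> \<phi> \<in> w" if "\<theta> \<notin> w" for \<theta>
  proof (rule ccontr)
    assume n: "Imp \<theta> \<phi> \<notin> w"
    \<comment> \<open>By the deduction theorem, this is the theory generated by \<open>w\<close> and \<open>\<theta>\<close>.\<close>
    let ?X = "{\<psi>. Imp \<theta> \<psi> \<in> w}"
    have sub: "w \<subseteq> ?X"
      using theory_taut1[OF w(1)] by (auto simp: tautology_def)
    have "is_theory ?X"
      unfolding is_theory_def
    proof (intro conjI allI impI)
      show "L \<subseteq> ?X" using sub theory_supset[OF w(1)] by blast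
      fix \<alpha> \<beta> assume "\<alpha> \<in> ?X" "Imp \<alpha> \<beta> \<in> ?X"
      then show "\<beta> \<in> ?X"
        using theory_taut2[OF w(1), of "Imp \<theta> \<alpha>" "Imp \<theta> (Imp \<alpha> \<beta>)" "Imp \<theta> \<beta>"]
        by (simp add: tautology_def)
    qed
    then have "?X \<in> ?A" using sub w(2) n by simp
    with maximal sub have "?X = w" by simp
    moreover have "Imp \<theta> \<theta> \<in> w"
      using theory_taut[OF w(1), of "Imp \<theta> \<theta>"] by (simp add: tautology_def)
    ultimately show False using that by blast
  qed
  have "complete_theory w"
    unfolding complete_theory_def
  proof (intro conjI allI iffI w(1))
    fix \<theta> assume "Neg \<theta> \<in> w"
    then show "\<theta> \<notin> w"
      using theory_taut2[OF w(1), of \<theta> "Neg \<theta>" \<phi>] w(3) by (auto simp: tautology_def)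
  next
    fix \<theta> assume "\<theta> \<notin> w"
    show "Neg \<theta> \<in> w"
    proof (rule ccontr)
      assume "Neg \<theta> \<notin> w"
      then show False
        using theory_taut2[OF w(1) ext[OF \<open>\<theta> \<notin> w\<close>] ext, of "Neg \<theta>" \<phi>] w(3)
        by (auto simp: tautology_def)
    qed
  qed
  then show thesis using that w by blast
qed

text \<open>The accessibility relation of the canonical model.\<close>

definition sees :: "fm set \<Rightarrow> fm set \<Rightarrow> bool" where
  "sees w v \<longleftrightarrow> (\<forall>\<psi>. \<psi> \<in> v \<longrightarrow> Dia \<psi> \<in> w)"

lemma sees_refl:
  assumes "complete_theory w"
  shows "sees w w"
  using complete_theory_L[OF assms refl_axiom] by (simp add: sees_def complete_theory_imp[OF assms])

lemma sees_dia:
  assumes "complete_theory w" "sees w v" "Dia \<psi> \<in> v"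
  shows "Dia \<psi> \<in> w"
proof -
  have "Imp (Dia (Dia \<psi>)) (Dia \<psi>) \<in> w" using complete_theory_L[OF assms(1) trans_axiom] .
  moreover have "Dia (Dia \<psi>) \<in> w" using assms(2,3) by (simp add: sees_def)
  ultimately show ?thesis by (simp add: complete_theory_imp[OF assms(1)])
qed

text \<open>The existence lemma of the canonical model: complete the theory generated by \<open>\<psi>\<close> and all
  formulas that are necessary at \<open>w\<close>.\<close>

lemma dia_witness:
  assumes w: "complete_theory w" and d: "Dia \<psi> \<in> w"
  obtains v where "complete_theory v" "sees w v" "\<psi> \<in> v"
proof -
  \<comment> \<open>\<open>\<theta> \<in> T\<close> says that the implication from \<open>\<psi>\<close> to \<open>\<theta>\<close> is necessary at \<open>w\<close>.\<close>
  define T where "T = {\<theta>. Dia (And \<psi> (Neg \<theta>)) \<notin> w}"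
  have mono: "Dia \<beta> \<in> w" if "Dia \<alpha> \<in> w" "tautology (Imp \<alpha> \<beta>)" for \<alpha> \<beta>
    using complete_theory_L[OF w dia_mono[OF taut[OF that(2)]]] that(1)
    by (simp add: complete_theory_imp[OF w])
  have bot: "Dia Bot \<notin> w"
    using complete_theory_iff[OF w dia_bot] complete_theory_top_bot[OF w] by simp
  have "is_theory T"
    unfolding is_theory_def
  proof (intro conjI allI impI subsetI)
    fix \<theta> assume "\<theta> \<in> L"
    then have "Imp (And \<psi> (Neg \<theta>)) Bot \<in> L"
      by (rule theory_taut1[OF is_theory_L]) (simp add: tautology_def)
    from complete_theory_L[OF w dia_mono[OF this]] show "\<theta> \<in> T"
      using bot by (simp add: T_def complete_theory_imp[OF w])
  next
    fix \<alpha> \<beta> assume ab: "\<alpha> \<in> T" "Imp \<alpha> \<beta> \<in> T"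
    show "\<beta> \<in> T"
    proof (rule ccontr)
      assume "\<beta> \<notin> T"
      then have "Dia (And \<psi> (Neg \<beta>)) \<in> w" by (simp add: T_def)
      then have "Dia (Or (And \<psi> (Neg \<alpha>)) (And \<psi> (Neg (Imp \<alpha> \<beta>)))) \<in> w"
        by (rule mono) (auto simp: tautology_def)
      then show False
        using ab complete_theory_iff[OF w dia_or[of "And \<psi> (Neg \<alpha>)" "And \<psi> (Neg (Imp \<alpha> \<beta>))"]]
        by (simp add: T_def complete_theory_or[OF w])
    qed
  qed
  moreover have "Bot \<notin> T"
    using mono[OF d] by (auto simp: T_def tautology_def)
  ultimately obtain v where v: "complete_theory v" "T \<subseteq> v" "Bot \<notin> v"
    by (rule complete_theory_extends)
  have "\<psi> \<in> T"
    using mono[of "And \<psi> (Neg \<psi>)" Bot] bot by (auto simp: T_def tautology_def)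
  moreover have "sees w v"
    unfolding sees_def
  proof (intro allI impI, rule ccontr)
    fix \<theta> assume \<theta>: "\<theta> \<in> v" "Dia \<theta> \<notin> w"
    then have "Neg \<theta> \<in> T"
      using mono[of "And \<psi> (Neg (Neg \<theta>))" \<theta>] by (auto simp: T_def tautology_def)
    then show False using v(2) \<theta>(1) complete_theory_neg[OF v(1), of \<theta>] by blast
  qed
  ultimately show thesis using that v by blast
qed

end

section \<open>The general space of a complete theory\<close>

instance fm :: countable
  by countable_datatype

text \<open>The second component of the decoded pair is ignored, so that each formula is listed
  infinitely often.\<close>

definition agenda :: "nat \<Rightarrow> fm" where
  "agenda n = from_nat (fst (prod_decode n))"

lemma agenda_recurs: "\<exists>N\<ge>n. agenda N = \<psi>"
proof (intro exI conjI)
  show "agenda (prod_encode (to_nat \<psi>, n)) = \<psi>" by (simp add: agenda_def)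
  show "n \<le> prod_encode (to_nat \<psi>, n)" by (rule le_prod_encode_2)
qed

context S4_logic
begin

definition serve :: "fm \<Rightarrow> fm set \<Rightarrow> fm set" where
  "serve \<psi> w =
     (if Dia \<psi> \<in> w then SOME v. complete_theory v \<and> sees w v \<and> \<psi> \<in> v else w)"

primrec label :: "fm set \<Rightarrow> (nat \<Rightarrow> bool) \<Rightarrow> nat \<Rightarrow> fm set" where
  "label w x 0 = w"
| "label w x (Suc n) = (if x n then serve (agenda n) (label w x n) else label w x n)"

text \<open>An arbitrary completion of the eventual theory of the branch; everything below holds for
  whichever completion is chosen.\<close>

definition limit_label :: "fm set \<Rightarrow> (nat \<Rightarrow> bool) \<Rightarrow> fm set" where
  "limit_label w x =
     (SOME v. complete_theory v \<and> {\<psi>. \<forall>\<^sub>F n in sequentially. \<psi> \<in> label w x n} \<subseteq> v)"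

definition truth_set :: "fm set \<Rightarrow> fm \<Rightarrow> (nat \<Rightarrow> bool) set" where
  "truth_set w \<psi> = {x. \<psi> \<in> limit_label w x}"

lemma serve_dia:
  assumes "complete_theory w" "Dia \<psi> \<in> w"
  shows "complete_theory (serve \<psi> w) \<and> sees w (serve \<psi> w) \<and> \<psi> \<in> serve \<psi> w"
proof -
  have "\<exists>v. complete_theory v \<and> sees w v \<and> \<psi> \<in> v" using dia_witness[OF assms] by blast
  from someI_ex[OF this] show ?thesis using assms(2) by (simp add: serve_def)
qed

lemma serve_complete: "complete_theory w \<Longrightarrow> complete_theory (serve \<psi> w)"
  and sees_serve: "complete_theory w \<Longrightarrow> sees w (serve \<psi> w)"
  using serve_dia[of w \<psi>] sees_refl[of w] by (cases "Dia \<psi> \<in> w"; simp add: serve_def)+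

lemma label_cong: "\<forall>i<n. y i = x i \<Longrightarrow> label w y n = label w x n"
  by (induction n) auto

lemma label_const:
  assumes "\<And>i. m \<le> i \<Longrightarrow> i < n \<Longrightarrow> \<not> x i" "m \<le> n"
  shows "label w x n = label w x m"
  using assms(2,1) by (induction n rule: dec_induct) auto

context
  fixes w
  assumes w: "complete_theory w"
begin

lemma label_complete: "complete_theory (label w x n)"
  by (induction n) (auto simp: w serve_complete)

lemma label_dia_antimono:
  assumes "m \<le> n" "Dia \<psi> \<in> label w x n"
  shows "Dia \<psi> \<in> label w x m"
  using assms
proof (induction n rule: dec_induct)
  case (step n)
  then have "Dia \<psi> \<in> label w x n"
    using sees_dia[OF label_complete sees_serve[OF label_complete], of \<psi>] by (auto split: if_splits)
  then show ?case using step by blast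
qed

lemma limit_label:
  shows limit_label_complete: "complete_theory (limit_label w x)"
    and eventually_label_imp_limit:
      "\<forall>\<^sub>F n in sequentially. \<psi> \<in> label w x n \<Longrightarrow> \<psi> \<in> limit_label w x"
proof -
  let ?T = "{\<psi>. \<forall>\<^sub>F n in sequentially. \<psi> \<in> label w x n}"
  have "is_theory ?T"
    unfolding is_theory_def
  proof (intro conjI allI impI)
    show "L \<subseteq> ?T" using complete_theory_L[OF label_complete] by auto
    fix \<alpha> \<beta> assume a: "\<alpha> \<in> ?T" "Imp \<alpha> \<beta> \<in> ?T"
    then have "\<forall>\<^sub>F n in sequentially. \<alpha> \<in> label w x n" "\<forall>\<^sub>F n in sequentially. Imp \<alpha> \<beta> \<in> label w x n"
      by auto
    then have "\<forall>\<^sub>F n in sequentially. \<beta> \<in> label w x n"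
      by eventually_elim (use complete_theory_imp[OF label_complete] in blast)
    then show "\<beta> \<in> ?T" by simp
  qed
  moreover have "Bot \<notin> ?T" using complete_theory_top_bot(2)[OF label_complete] by simp
  ultimately obtain v where "complete_theory v" "?T \<subseteq> v" by (rule complete_theory_extends)
  then have "\<exists>v. complete_theory v \<and> ?T \<subseteq> v" by blast
  from someI_ex[OF this]
  have "complete_theory (limit_label w x) \<and> ?T \<subseteq> limit_label w x" unfolding limit_label_def .
  then show "complete_theory (limit_label w x)"
    "\<forall>\<^sub>F n in sequentially. \<psi> \<in> label w x n \<Longrightarrow> \<psi> \<in> limit_label w x" by blast+
qed

text \<open>By \<open>label_dia_antimono\<close>, if \<open>Dia \<psi>\<close> is missing from some label then its negation is in all
  later ones, hence in the limit.\<close>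

lemma dia_in_limit_label_iff: "Dia \<psi> \<in> limit_label w x \<longleftrightarrow> (\<forall>n. Dia \<psi> \<in> label w x n)"
proof
  assume d: "Dia \<psi> \<in> limit_label w x"
  show "\<forall>n. Dia \<psi> \<in> label w x n"
  proof (rule ccontr)
    assume "\<not> ?thesis"
    then obtain m where "Dia \<psi> \<notin> label w x m" by blast
    then have "Neg (Dia \<psi>) \<in> label w x n" if "m \<le> n" for n
      using label_dia_antimono[OF that] complete_theory_neg[OF label_complete] by blast
    then have "Neg (Dia \<psi>) \<in> limit_label w x"
      by (intro eventually_label_imp_limit) (auto simp: eventually_sequentially)
    then show False using d complete_theory_neg[OF limit_label_complete] by blast
  qed
qed (simp add: eventually_label_imp_limit)

text \<open>If all labels along \<open>x\<close> contain \<open>Dia \<psi>\<close>, then from any depth one can leave \<open>x\<close> for a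
  witness of \<open>\<psi>\<close> and stay there by bits \<open>False\<close>. Conversely, a branch \<open>y\<close> close to \<open>x\<close> whose limit
  contains \<open>\<psi>\<close> has \<open>Dia \<psi>\<close> in its limit by reflexivity, hence in the initial labels that it shares
  with \<open>x\<close>.\<close>

lemma truth_set_dia: "truth_set w (Dia \<psi>) = cantor_space closure_of truth_set w \<psi>"
proof (intro set_eqI iffI)
  fix x assume "x \<in> truth_set w (Dia \<psi>)"
  then have d: "Dia \<psi> \<in> label w x n" for n by (simp add: truth_set_def dia_in_limit_label_iff)
  show "x \<in> cantor_space closure_of truth_set w \<psi>"
    unfolding in_closure_cantor_iff
  proof
    fix n
    obtain N where N: "N \<ge> n" "agenda N = \<psi>" using agenda_recurs by blast
    \<comment> \<open>Follow \<open>x\<close> up to depth \<open>n\<close>, wait until \<open>\<psi>\<close> is on the agenda, move to a witness, and stay.\<close>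
    define y where "y i = (if i < n then x i else i = N)" for i
    have "label w y N = label w y n" by (rule label_const) (use N in \<open>auto simp: y_def\<close>)
    also have "\<dots> = label w x n" by (rule label_cong) (simp add: y_def)
    finally have "Dia \<psi> \<in> label w y N" using d by simp
    then have "\<psi> \<in> label w y (Suc N)"
      using serve_dia[OF label_complete] N by (simp add: y_def)
    moreover have "label w y m = label w y (Suc N)" if "Suc N \<le> m" for m
      by (rule label_const) (use N that in \<open>auto simp: y_def\<close>)
    ultimately have "\<forall>m\<ge>Suc N. \<psi> \<in> label w y m" by simp
    then have "\<psi> \<in> limit_label w y"
      by (intro eventually_label_imp_limit) (auto simp only: eventually_sequentially)
    then show "\<exists>y\<in>truth_set w \<psi>. \<forall>i<n. y i = x i"
      by (intro bexI[of _ y]) (auto simp: truth_set_def y_def)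
  qed
next
  fix x assume x: "x \<in> cantor_space closure_of truth_set w \<psi>"
  have "Dia \<psi> \<in> label w x n" for n
  proof -
    obtain y where y: "\<psi> \<in> limit_label w y" "\<forall>i<n. y i = x i"
      using x unfolding in_closure_cantor_iff truth_set_def by blast
    from y(1) have "Dia \<psi> \<in> limit_label w y"
      using sees_refl[OF limit_label_complete] unfolding sees_def by blast
    then have "Dia \<psi> \<in> label w y n" by (simp add: dia_in_limit_label_iff)
    then show ?thesis by (simp add: label_cong[OF y(2)])
  qed
  then show "x \<in> truth_set w (Dia \<psi>)" by (simp add: truth_set_def dia_in_limit_label_iff)
qed

lemma truth_set_simps:
  "truth_set w Top = UNIV"
  "truth_set w Bot = {}"
  "truth_set w (Neg \<phi>) = - truth_set w \<phi>"
  "truth_set w (And \<phi> \<psi>) = truth_set w \<phi> \<inter> truth_set w \<psi>"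
  "truth_set w (Or \<phi> \<psi>) = truth_set w \<phi> \<union> truth_set w \<psi>"
  "truth_set w (Imp \<phi> \<psi>) = - truth_set w \<phi> \<union> truth_set w \<psi>"
  "truth_set w (Box \<phi>) = truth_set w (Neg (Dia (Neg \<phi>)))"
  using limit_label_complete
  by (auto simp: truth_set_def complete_theory_neg complete_theory_and complete_theory_or
      complete_theory_imp complete_theory_box complete_theory_top_bot)

lemma eval_truth_set: "cantor_eval (\<lambda>n. truth_set w (\<sigma> n)) \<phi> = truth_set w (fsubst \<sigma> \<phi>)"
  by (induction \<phi>)
     (simp_all add: space_algebra_def truth_set_simps truth_set_dia Compl_eq_Diff_UNIV)

lemma general_space_truth_sets: "general_space cantor_space (range (truth_set w))"
  unfolding general_space_cantor_iff
  by (auto simp: truth_set_simps[symmetric] truth_set_dia[symmetric] simp del: truth_set_simps)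

text \<open>A valuation in truth sets is a substitution, by \<open>eval_truth_set\<close>; and \<open>L\<close> is closed under
  substitution.\<close>

lemma logic_subset_truth_sets: "L \<subseteq> general_space_logic cantor_space (range (truth_set w))"
proof
  fix \<phi> assume \<phi>: "\<phi> \<in> L"
  show "\<phi> \<in> general_space_logic cantor_space (range (truth_set w))"
    unfolding mem_general_space_logic_cantor
  proof (intro allI impI)
    fix v :: "nat \<Rightarrow> (nat \<Rightarrow> bool) set" assume "range v \<subseteq> range (truth_set w)"
    then have "\<forall>n. \<exists>\<psi>. v n = truth_set w \<psi>" by blast
    then obtain \<sigma> where \<sigma>: "v = (\<lambda>n. truth_set w (\<sigma> n))" by metis
    have "fsubst \<sigma> \<phi> \<in> limit_label w x" for x
      using complete_theory_L[OF limit_label_complete subst[OF \<phi>]] .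
    then show "cantor_eval v \<phi> = UNIV"
      unfolding \<sigma> eval_truth_set by (auto simp: truth_set_def)
  qed
qed

text \<open>The branch of constant \<open>False\<close> has label \<open>w\<close> throughout, so its limit is \<open>w\<close>.\<close>

lemma truth_sets_refute:
  assumes "\<phi> \<notin> w"
  shows "\<phi> \<notin> general_space_logic cantor_space (range (truth_set w))"
proof
  assume "\<phi> \<in> general_space_logic cantor_space (range (truth_set w))"
  then have "cantor_eval (\<lambda>n. truth_set w (Var n)) \<phi> = UNIV"
    by (rule general_space_logic_cantorD) auto
  moreover have "fsubst Var \<phi> = \<phi>" by (induction \<phi>) simp_all
  ultimately have "\<phi> \<in> limit_label w (\<lambda>_. False)"
    using eval_truth_set[of Var \<phi>] by (auto simp: truth_set_def)
  moreover have "label w (\<lambda>_. False) n = w" for n by (induction n) simp_all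
  then have "Neg \<phi> \<in> limit_label w (\<lambda>_. False)"
    using assms complete_theory_neg[OF w] by (intro eventually_label_imp_limit) simp
  ultimately show False using complete_theory_neg[OF limit_label_complete] by blast
qed

end

section \<open>The characterization\<close>

lemma logic_of_general_cantor_space:
  assumes "Bot \<notin> L"
  shows "\<exists>P. general_space cantor_space P \<and> L = general_space_logic cantor_space P"
proof -
  have "\<exists>w. complete_theory w \<and> \<phi> \<notin> w" if "\<phi> \<notin> L" for \<phi>
    using complete_theory_extends[OF is_theory_L that] by blast
  then obtain W where W: "\<And>\<phi>. \<phi> \<notin> L \<Longrightarrow> complete_theory (W \<phi>) \<and> \<phi> \<notin> W \<phi>"
    by metis
  \<comment> \<open>An enumeration of all formulas outside \<open>L\<close>; consistency of \<open>L\<close> supplies the filler \<open>Bot\<close>.\<close>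
  define e where "e k = (if (from_nat k :: fm) \<in> L then Bot else from_nat k)" for k
  have e: "e k \<notin> L" for k using assms by (simp add: e_def)
  have e_onto: "\<exists>k. e k = \<phi>" if "\<phi> \<notin> L" for \<phi>
    using that by (intro exI[of _ "to_nat \<phi>"]) (simp add: e_def)
  define P where "P k = range (truth_set (W (e k)))" for k
  have P: "general_space cantor_space (P k)" for k
    unfolding P_def using general_space_truth_sets W[OF e] by blast
  have "L = (\<Inter>k. general_space_logic cantor_space (P k))"
  proof (intro equalityI subsetI)
    show "\<phi> \<in> (\<Inter>k. general_space_logic cantor_space (P k))" if "\<phi> \<in> L" for \<phi>
      unfolding P_def using logic_subset_truth_sets W[OF e] that by blast
    show "\<phi> \<in> L" if \<phi>: "\<phi> \<in> (\<Inter>k. general_space_logic cantor_space (P k))" for \<phi>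
    proof (rule ccontr)
      assume "\<phi> \<notin> L"
      then obtain k where "e k = \<phi>" using e_onto by blast
      then show False
        using \<phi> truth_sets_refute W[OF e, of k] unfolding P_def by blast
    qed
  qed
  then show ?thesis
    using general_space_cantor_sum[of P] general_space_logic_cantor_sum[of P] P by metis
qed

end

lemma closure_axioms_in_general_space_logic:
  "Imp \<phi> (Dia \<phi>) \<in> general_space_logic cantor_space P"
  "Imp (Dia (Dia \<phi>)) (Dia \<phi>) \<in> general_space_logic cantor_space P"
proof -
  have "S \<subseteq> cantor_space closure_of S" for S by (rule closure_of_subset) simp
  then show "Imp \<phi> (Dia \<phi>) \<in> general_space_logic cantor_space P"
    "Imp (Dia (Dia \<phi>)) (Dia \<phi>) \<in> general_space_logic cantor_space P"
    by (auto simp: mem_general_space_logic_cantor space_algebra_def)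
qed

lemma closure_axioms_in_S4: "Imp \<phi> (Dia \<phi>) \<in> S4" "Imp (Dia (Dia \<phi>)) (Dia \<phi>) \<in> S4"
  by (auto simp: S4_def)

lemma subalgebra_cantor_iff_general_space:
  "subalgebra A (space_algebra cantor_space) \<longleftrightarrow>
     (\<exists>P. general_space cantor_space P \<and> A = (space_algebra cantor_space)\<lparr>carrier := P\<rparr>)"
proof
  assume A: "subalgebra A (space_algebra cantor_space)"
  then have "general_space cantor_space (carrier A)"
    by (auto simp: subalgebra_def space_algebra_def general_space_cantor_iff Compl_eq_Diff_UNIV)
  moreover have "A = (space_algebra cantor_space)\<lparr>carrier := carrier A\<rparr>"
    using A unfolding subalgebra_def by blast
  ultimately show
    "\<exists>P. general_space cantor_space P \<and> A = (space_algebra cantor_space)\<lparr>carrier := P\<rparr>" by blast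
next
  assume "\<exists>P. general_space cantor_space P \<and> A = (space_algebra cantor_space)\<lparr>carrier := P\<rparr>"
  then obtain P where P: "general_space cantor_space P"
    and A: "A = (space_algebra cantor_space)\<lparr>carrier := P\<rparr>" by blast
  interpret algebra UNIV P using P by (simp add: general_space_def)
  show "subalgebra A (space_algebra cantor_space)"
    using P unfolding A subalgebra_def
    by (auto simp: space_algebra_def general_space_def)
qed

theorem theorem7p5:
  fixes L :: "fm set"
  assumes "normal_modal_logic L"
    and consistent: "Bot \<notin> L"
  shows "(logic_above_S4 L \<longleftrightarrow>
            (\<exists>P. general_space cantor_space P \<and> L = general_space_logic cantor_space P)) \<and>
         ((\<exists>P. general_space cantor_space P \<and> L = general_space_logic cantor_space P) \<longleftrightarrow>
            (\<exists>A. subalgebra A (space_algebra cantor_space) \<and> L = alg_logic A))"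
proof (intro conjI iffI)
  assume "logic_above_S4 L"
  then have "S4_logic L"
    using closure_axioms_in_S4 by unfold_locales (auto simp: logic_above_S4_def)
  then show "\<exists>P. general_space cantor_space P \<and> L = general_space_logic cantor_space P"
    using consistent by (rule S4_logic.logic_of_general_cantor_space)
next
  assume "\<exists>P. general_space cantor_space P \<and> L = general_space_logic cantor_space P"
  then have "Imp \<phi> (Dia \<phi>) \<in> L" "Imp (Dia (Dia \<phi>)) (Dia \<phi>) \<in> L" for \<phi>
    using closure_axioms_in_general_space_logic by blast+
  then show "logic_above_S4 L"
    using assms(1) by (auto simp: logic_above_S4_def S4_def)
qed (auto simp: subalgebra_cantor_iff_general_space general_space_logic_def)

end
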